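(* The relations $\overset{\mathrm{irr}}{\sim}$ and $\overset{\mathrm{bal}}{\sim}$ on $\mathcal{M}$ coincide: if $v$ can be obtained from $w$ by a sequence of balanced commutations, then $v$ can also be obtained from $w$ by a sequence of irreducible balanced commutations.
   Context: $\mathcal{M}$ is the free monoid on letters $D,U$. A word is balanced if it has equally many $D$'s and $U$'s. A balanced word is irreducible if it is nonempty and is not a concatenation of two nonempty balanced words. A balanced commutation turns $pyxq$ into $pxyq$ for words $p,q$ and balanced words $x,y$; an irreducible balanced commutation is one where additionally $x,y$ are irreducible balanced words with different first letters. $\overset{\mathrm{bal}}{\sim}$ (resp. $\overset{\mathrm{irr}}{\sim}$) is the equivalence relation "obtainable by a finite sequence of balanced (resp. irreducible balanced) commutations". *)

theory Defs
  imports Main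
begin

datatype letter = D | U

text \<open>The free monoid on \<open>D\<close>, \<open>U\<close> is the type of lists over \<open>letter\<close>, with append as product.\<close>

type_synonym word = "letter list"

definition balanced :: "word \<Rightarrow> bool" where
  "balanced w \<longleftrightarrow> count_list w D = count_list w U"

definition irreducible_balanced :: "word \<Rightarrow> bool" where
  "irreducible_balanced w \<longleftrightarrow>
     balanced w \<and> w \<noteq> [] \<and>
     \<not> (\<exists>u v. u \<noteq> [] \<and> v \<noteq> [] \<and> balanced u \<and> balanced v \<and> w = u @ v)"

inductive bal_comm :: "word \<Rightarrow> word \<Rightarrow> bool" where
  "balanced x \<Longrightarrow> balanced y \<Longrightarrow> bal_comm (p @ y @ x @ q) (p @ x @ y @ q)"

text \<open>Irreducible words are nonempty, so \<open>hd\<close> is meaningful below.\<close>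

inductive irr_comm :: "word \<Rightarrow> word \<Rightarrow> bool" where
  "irreducible_balanced x \<Longrightarrow> irreducible_balanced y \<Longrightarrow> hd x \<noteq> hd y
     \<Longrightarrow> irr_comm (p @ y @ x @ q) (p @ x @ y @ q)"

text \<open>Single commutations are symmetric (exchange \<open>x\<close> and \<open>y\<close>), so the reflexive transitive
  closures, i.e. finite and possibly empty sequences of commutations, are equivalence relations.\<close>

definition bal_equiv :: "word \<Rightarrow> word \<Rightarrow> bool" where
  "bal_equiv = bal_comm\<^sup>*\<^sup>*"

definition irr_equiv :: "word \<Rightarrow> word \<Rightarrow> bool" where
  "irr_equiv = irr_comm\<^sup>*\<^sup>*"

lemma symp_bal_comm: "symp bal_comm"
  by (rule sympI) (auto elim!: bal_comm.cases intro: bal_comm.intros)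

lemma symp_irr_comm: "symp irr_comm"
  by (rule sympI) (auto elim!: irr_comm.cases intro!: irr_comm.intros)

lemma equivp_bal_equiv: "equivp bal_equiv"
  unfolding bal_equiv_def
  by (auto intro!: equivpI reflpI transpI symp_rtranclp symp_bal_comm)

lemma equivp_irr_equiv: "equivp irr_equiv"
  unfolding irr_equiv_def
  by (auto intro!: equivpI reflpI transpI symp_rtranclp symp_irr_comm)

end

theory Submission
  imports Defs
begin

text \<open>It suffices that any two balanced words \<open>x\<close>, \<open>y\<close> satisfy \<open>x y \<sim> y x\<close> under irreducible
  commutations, which goes by induction on the total length. Reducible words are moved factor by
  factor, and irreducible words with different first letters commute directly. Otherwise
  \<open>x = c a d\<close> and \<open>y = c b d\<close> with \<open>{c, d} = {D, U}\<close> and \<open>a\<close>, \<open>b\<close> balanced, and the block \<open>d c\<close>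
  in the middle is itself a balanced word, so the induction hypothesis gives
  \<open>c a (d c) b d \<sim> c (d c) a b d \<sim> c (d c) b a d \<sim> c b (d c) a d\<close>.\<close>

lemma letter_other: "(c :: letter) \<noteq> d \<Longrightarrow> d \<noteq> e \<Longrightarrow> c = e"
  by (cases c; cases d; cases e) auto

text \<open>Makes the two letters interchangeable, so that later arguments treat \<open>D\<close>
  and \<open>U\<close> at once.\<close>

lemma balanced_iff:
  assumes "c \<noteq> d"
  shows "balanced w \<longleftrightarrow> count_list w c = count_list w d"
  using assms unfolding balanced_def by (cases c; cases d) auto

lemma irr_equiv_refl: "irr_equiv w w"
  by (simp add: irr_equiv_def)

lemma irr_equiv_trans [trans]: "irr_equiv u v \<Longrightarrow> irr_equiv v w \<Longrightarrow> irr_equiv u w"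
  by (simp add: irr_equiv_def)

lemma irr_comm_context: "irr_comm u v \<Longrightarrow> irr_comm (p @ u @ q) (p @ v @ q)"
proof (induction rule: irr_comm.induct)
  case (1 x y p' q')
  then show ?case
    using irr_comm.intros[of x y "p @ p'" "q' @ q"] by simp
qed

lemma irr_equiv_context: "irr_equiv u v \<Longrightarrow> irr_equiv (p @ u @ q) (p @ v @ q)"
  unfolding irr_equiv_def
  by (induction rule: rtranclp_induct) (auto intro: rtranclp.rtrancl_into_rtrancl irr_comm_context)

lemma irr_comm_imp_bal_comm: "irr_comm u v \<Longrightarrow> bal_comm u v"
  by (auto elim!: irr_comm.cases intro!: bal_comm.intros simp: irreducible_balanced_def)

text \<open>A discrete intermediate value argument: the \<open>d\<close> exhibited is the one at which the count of
  \<open>d\<close> first exceeds that of \<open>c\<close>.\<close>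

lemma first_excess:
  assumes "c \<noteq> d" "count_list w c < count_list w d"
  shows "\<exists>u v. w = u @ d # v \<and> balanced u"
  using assms(2)
proof (induction w rule: rev_induct)
  case Nil
  then show ?case by simp
next
  case (snoc l w)
  show ?case
  proof (cases "count_list w c < count_list w d")
    case True
    then obtain u v where "w = u @ d # v" "balanced u"
      using snoc.IH by blast
    then have "w @ [l] = u @ d # (v @ [l])" "balanced u" by auto
    then show ?thesis by blast
  next
    case False
    \<comment> \<open>One letter turns no excess into an excess, so \<open>w\<close> was tied and
      serves as \<open>u\<close>, with \<open>v\<close> empty.\<close>
    then have "l = d" "balanced w"
      using snoc.prems assms(1) by (auto simp: balanced_iff[OF assms(1)] split: if_splits)
    then show ?thesis by blast
  qed
qed

text \<open>If \<open>x\<close> began and ended with the same letter, its running balance would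
  return to zero strictly inside, splitting \<open>x\<close> into two balanced words.\<close>

lemma irreducible_balanced_decomp:
  assumes irr: "irreducible_balanced x" and neq: "hd x \<noteq> d"
  obtains a where "x = hd x # a @ [d]" "balanced a"
proof -
  define c where "c = hd x"
  have cd: "c \<noteq> d" using neq by (simp add: c_def)
  have bal: "count_list x c = count_list x d" and "x \<noteq> []"
    using irr by (auto simp: irreducible_balanced_def balanced_iff[OF cd])
  then obtain t where t: "x = c # t"
    by (cases x) (auto simp: c_def)
  with bal cd have "t \<noteq> []" by auto
  then obtain a e where ae: "t = a @ [e]"
    by (metis rev_exhaust)
  have "e = d"
  proof (rule ccontr)
    assume "e \<noteq> d"
    then have e: "e = c" using letter_other[of c d e] cd by auto
    \<comment> \<open>Both end letters are \<open>c\<close>, so \<open>a\<close> has two more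
      \<open>d\<close> than \<open>c\<close>.\<close>
    then have "count_list a c < count_list a d"
      using bal cd t ae by simp
    then obtain u v where uv: "a = u @ d # v" "balanced u"
      using first_excess[OF cd] by blast
    have "x = (c # u @ [d]) @ (v @ [c])"
      using t ae e uv by simp
    moreover have "balanced (c # u @ [d])" "balanced (v @ [c])"
      using uv bal cd t ae e by (auto simp: balanced_iff[OF cd])
    ultimately show False
      using irr unfolding irreducible_balanced_def by blast
  qed
  then have "x = c # a @ [d]" "balanced a"
    using t ae bal cd by (auto simp: balanced_iff[OF cd])
  then show thesis using that by (simp add: c_def)
qed

lemma balanced_commute_irr_equiv:
  assumes "balanced x" "balanced y"
  shows "irr_equiv (x @ y) (y @ x)"
  using assms
proof (induction "length x + length y" arbitrary: x y rule: less_induct)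
  case less
  show ?case
  proof (cases "x = [] \<or> y = []")
    case True
    then show ?thesis by (auto intro: irr_equiv_refl)
  next
    case nonempty: False
    consider (redx) "\<not> irreducible_balanced x" | (redy) "\<not> irreducible_balanced y"
      | (irr) "irreducible_balanced x" "irreducible_balanced y" by blast
    then show ?thesis
    proof cases
      case redx
      then obtain u v where uv: "u \<noteq> []" "v \<noteq> []" "balanced u" "balanced v" "x = u @ v"
        using less.prems nonempty by (auto simp: irreducible_balanced_def)
      \<comment> \<open>\<open>y\<close> passes \<open>v\<close>, then \<open>u\<close>; each
        exchange is shorter because the other factor is nonempty.\<close>
      have "irr_equiv (u @ (v @ y) @ []) (u @ (y @ v) @ [])"
        using uv less by (intro irr_equiv_context less.hyps) auto
      also have "irr_equiv (u @ (y @ v) @ []) ([] @ (y @ u) @ v)"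
        using uv less irr_equiv_context[of "u @ y" "y @ u" "[]" v] by auto
      finally show ?thesis using uv by simp
    next
      case redy
      then obtain u v where uv: "u \<noteq> []" "v \<noteq> []" "balanced u" "balanced v" "y = u @ v"
        using less.prems nonempty by (auto simp: irreducible_balanced_def)
      have "irr_equiv ([] @ (x @ u) @ v) ([] @ (u @ x) @ v)"
        using uv less by (intro irr_equiv_context less.hyps) auto
      also have "irr_equiv ([] @ (u @ x) @ v) (u @ (v @ x) @ [])"
        using uv less irr_equiv_context[of "x @ v" "v @ x" u "[]"] by auto
      finally show ?thesis using uv by simp
    next
      case irr
      show ?thesis
      proof (cases "hd x = hd y")
        case False
        then have "irr_comm ([] @ x @ y @ []) ([] @ y @ x @ [])"
          using irr by (intro irr_comm.intros) auto
        then show ?thesis by (simp add: irr_equiv_def)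
      next
        case True
        define c where "c = hd x"
        obtain d where cd: "c \<noteq> d" by (metis letter.distinct(1))
        obtain a where a: "x = c # a @ [d]" "balanced a"
          using irreducible_balanced_decomp[OF irr(1), of d] cd c_def by auto
        obtain b where b: "y = c # b @ [d]" "balanced b"
          using irreducible_balanced_decomp[OF irr(2), of d] cd c_def True by auto
        have dc: "balanced [d, c]"
          using cd by (simp add: balanced_iff[OF cd])
        \<comment> \<open>The induction hypothesis applies: \<open>a\<close> and
          \<open>[d, c]\<close> have total length \<open>length a + 2\<close>, below
          \<open>length a + length b + 4\<close>.\<close>
        have "irr_equiv ([c] @ (a @ [d, c]) @ b @ [d]) ([c] @ ([d, c] @ a) @ b @ [d])"
          using a b dc by (intro irr_equiv_context less.hyps) auto
        also have "irr_equiv \<dots> ([c, d, c] @ (b @ a) @ [d])"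
          using a b less.hyps[of a b] irr_equiv_context[of "a @ b" "b @ a" "[c, d, c]" "[d]"]
          by simp
        also have "irr_equiv \<dots> ([c] @ (b @ [d, c]) @ a @ [d])"
          using a b dc less.hyps[of "[d, c]" b]
            irr_equiv_context[of "[d, c] @ b" "b @ [d, c]" "[c]" "a @ [d]"]
          by simp
        finally show ?thesis using a b by simp
      qed
    qed
  qed
qed

lemma bal_comm_imp_irr_equiv: "bal_comm u v \<Longrightarrow> irr_equiv u v"
proof (induction rule: bal_comm.induct)
  case (1 x y p q)
  then show ?case
    using irr_equiv_context[OF balanced_commute_irr_equiv, of y x p q] by simp
qed

theorem theorem9p1:
  shows "irr_equiv = bal_equiv"
proof (intro ext iffI)
  fix u v
  assume "irr_equiv u v"
  then show "bal_equiv u v"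
    unfolding irr_equiv_def bal_equiv_def
    by (rule mono_rtranclp[rule_format, rotated]) (rule irr_comm_imp_bal_comm)
next
  fix u v
  assume "bal_equiv u v"
  then show "irr_equiv u v"
    unfolding bal_equiv_def
    by (induction rule: rtranclp_induct)
      (auto intro: irr_equiv_refl irr_equiv_trans bal_comm_imp_irr_equiv)
qed

end
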